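(* Let $G$ be a graph on $n$ vertices and let $r,s$ be nonnegative integers with $r+s\leq n$ such that $G$ does not contain the complete bipartite graph $K_{r,s}$ as a (not necessarily induced) subgraph. Then $\operatorname{Z}(\overline{G})\geq n-r-s+1$.
   Context: All graphs are finite, simple and undirected. For a graph $G$, $\overline{G}$ denotes its complement: same vertex set, and two distinct vertices are adjacent in $\overline{G}$ iff they are not adjacent in $G$. $K_{r,s}$ is the complete bipartite graph with parts of sizes $r$ and $s$. Zero forcing: given an initial set $B\subseteq V(G)$ of blue vertices (all others white), the color change rule allows a blue vertex that has exactly one white neighbor to turn that neighbor blue. $B$ is a zero forcing set if repeated application of the rule eventually makes every vertex blue. The zero forcing number $\operatorname{Z}(G)$ is the minimum size of a zero forcing set of $G$. *)

theory Defs
  imports "Graph_Theory.Graph_Theory"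
begin

text \<open>
  Finite simple undirected graphs are the \<^locale>\<open>pair_graph\<close>s of the library: finite,
  loop-free and symmetric, with an edge \<open>uv\<close> represented by the two arcs \<open>(u,v)\<close> and \<open>(v,u)\<close>.
\<close>

definition complement_graph :: "'a pair_pre_digraph \<Rightarrow> 'a pair_pre_digraph" where
  "complement_graph G = \<lparr> pverts = pverts G,
     parcs = {(u, v). u \<in> pverts G \<and> v \<in> pverts G \<and> u \<noteq> v \<and> (u, v) \<notin> parcs G} \<rparr>"

definition contains_complete_bipartite :: "'a pair_pre_digraph \<Rightarrow> nat \<Rightarrow> nat \<Rightarrow> bool" where
  "contains_complete_bipartite G r s \<longleftrightarrow>
     (\<exists>H :: 'a pair_pre_digraph. subgraph (with_proj H) (with_proj G) \<and>
        complete_bipartite_digraph r s (with_proj H))"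

definition white_neighbors :: "'a pair_pre_digraph \<Rightarrow> 'a set \<Rightarrow> 'a \<Rightarrow> 'a set" where
  "white_neighbors G B u = {v \<in> pverts G. v \<notin> B \<and> (u, v) \<in> parcs G}"

definition color_change :: "'a pair_pre_digraph \<Rightarrow> 'a set \<Rightarrow> 'a set \<Rightarrow> bool" where
  "color_change G B B' \<longleftrightarrow>
     (\<exists>u\<in>B. \<exists>w. white_neighbors G B u = {w} \<and> B' = insert w B)"

definition zero_forcing_set :: "'a pair_pre_digraph \<Rightarrow> 'a set \<Rightarrow> bool" where
  "zero_forcing_set G B \<longleftrightarrow> B \<subseteq> pverts G \<and> (color_change G)\<^sup>*\<^sup>* B (pverts G)"

definition zero_forcing_number :: "'a pair_pre_digraph \<Rightarrow> nat" where
  "zero_forcing_number G = (LEAST k. \<exists>B. zero_forcing_set G B \<and> card B = k)"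

lemma pair_graph_complement_graph:
  assumes "pair_graph G"
  shows "pair_graph (complement_graph G)"
proof -
  interpret pair_graph G by (fact assms)
  have "finite (parcs (complement_graph G))"
    by (rule finite_subset[of _ "pverts G \<times> pverts G"])
       (auto simp: complement_graph_def pair_finite_verts)
  moreover have "sym (parcs (complement_graph G))"
    using sym_arcs by (auto simp: complement_graph_def sym_def symmetric_def)
  ultimately show ?thesis
    by unfold_locales (auto simp: complement_graph_def pair_finite_verts symmetric_def)
qed

lemma zero_forcing_number_attained:
  "\<exists>B. zero_forcing_set G B \<and> card B = zero_forcing_number G"
  unfolding zero_forcing_number_def
  by (rule LeastI[of _ "card (pverts G)"]) (auto simp: zero_forcing_set_def)

end

theory Submission
  imports Defs
begin

text \<open>
  Vertices that perform successive forces are pairwise distinct, because a vertex has no white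
  neighbour left once it has forced. Starting from at most \<open>n - r - s\<close> blue vertices, stop after
  \<open>r\<close> forces: the \<open>r\<close> forcing vertices have no neighbour in the complement among the remaining
  white vertices, of which there are at least \<open>s\<close>; hence in \<open>G\<close> they are joined to all of these.
\<close>

text \<open>\<open>U\<close> collects the vertices that performed the \<open>k\<close> forces. Each
  force turns exactly one vertex blue, and white neighbourhoods only shrink, so once empty they stay
  empty.\<close>

lemma color_change_relpowp:
  assumes "(color_change H ^^ k) B C" "finite B" "B \<subseteq> pverts H"
  shows "finite C \<and> C \<subseteq> pverts H \<and> card C = card B + k \<and>
    (\<exists>U\<subseteq>C. card U = k \<and> (\<forall>u\<in>U. white_neighbors H C u = {}))"
  using assms(1)
proof (induction k arbitrary: C)
  case 0
  then show ?case using assms by auto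
next
  case (Suc k)
  then obtain D where D: "(color_change H ^^ k) B D" "color_change H D C"
    by (auto elim: relpowp_Suc_E)
  obtain u w where u: "u \<in> D" and w: "white_neighbors H D u = {w}" and C: "C = insert w D"
    using D(2) by (auto simp: color_change_def)
  have IH: "finite D" "D \<subseteq> pverts H" "card D = card B + k"
    using Suc.IH[OF D(1)] by auto
  obtain U where U: "U \<subseteq> D" "card U = k" "\<forall>u\<in>U. white_neighbors H D u = {}"
    using Suc.IH[OF D(1)] by auto
  have w': "w \<in> pverts H" "w \<notin> D"
    using w by (auto simp: white_neighbors_def)
  \<comment> \<open>The new forcing vertex still sees the white vertex \<open>w\<close>, whereas
    earlier forcing vertices see no white vertex.\<close>
  have "u \<notin> U" using U(3) w by auto
  moreover have "finite U" using U(1) IH(1) finite_subset by blast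
  ultimately have "card (insert u U) = Suc k" using U(2) by simp
  moreover have "white_neighbors H C x = {}" if "x \<in> insert u U" for x
    using that U(3) w unfolding C white_neighbors_def by blast
  ultimately show ?case
    using IH U(1) u w' unfolding C by (intro conjI exI[of _ "insert u U"]) auto
qed

text \<open>The subgraph need not be induced: keeping only the arcs between \<open>U\<close> and
  \<open>W\<close> discards any edges of \<open>G\<close> inside either part. The arcs in
  \<open>W \<times> U\<close> come from the symmetry of \<open>G\<close>.\<close>

lemma contains_complete_bipartiteI:
  assumes "pair_graph G" "U \<subseteq> pverts G" "W \<subseteq> pverts G" "U \<inter> W = {}" "U \<times> W \<subseteq> parcs G"
  shows "contains_complete_bipartite G (card U) (card W)"
proof -
  interpret pair_graph G by (fact assms(1))
  define H where "H = \<lparr>pverts = U \<union> W, parcs = U \<times> W \<union> W \<times> U\<rparr>"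
  have "finite (pverts H)"
    using assms pair_finite_verts by (auto simp: H_def intro: finite_subset)
  then have K: "complete_bipartite_digraph (card U) (card W) (with_proj H)"
    unfolding complete_bipartite_digraph_pair_def using assms(4) by (auto simp: H_def)
  have "pair_wf_digraph H"
    by unfold_locales (auto simp: H_def)
  moreover have "parcs H \<subseteq> parcs G"
    using assms(5) arcs_symmetric by (auto simp: H_def)
  moreover have "pverts H \<subseteq> pverts G"
    using assms(2,3) by (simp add: H_def)
  ultimately have "subgraph (with_proj H) (with_proj G)"
    unfolding subgraph_def by (auto simp: wf_digraph_wp_iff)
  with K show ?thesis unfolding contains_complete_bipartite_def by blast
qed

theorem theorem2p1:
  fixes G :: "'a pair_pre_digraph" and n r s :: nat
  assumes "pair_graph G"
    and "card (pverts G) = n"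
    and "r + s \<le> n"
    and "\<not> contains_complete_bipartite G r s"
  shows "zero_forcing_number (complement_graph G) \<ge> n - r - s + 1"
proof (rule ccontr)
  interpret pair_graph G by (fact assms(1))
  define H where "H = complement_graph G"
  have VH: "pverts H = pverts G" by (simp add: H_def complement_graph_def)
  assume "\<not> ?thesis"
  moreover obtain B where B: "zero_forcing_set H B" "card B = zero_forcing_number H"
    using zero_forcing_number_attained by blast
  \<comment> \<open>Subtraction on \<open>nat\<close> truncates; \<open>r + s \<le> n\<close> makes
    it exact here.\<close>
  ultimately have small: "card B + r + s \<le> n" using assms(3) by (simp add: H_def)
  have BV: "B \<subseteq> pverts H" using B(1) by (simp add: zero_forcing_set_def)
  then have finB: "finite B" using VH pair_finite_verts finite_subset by metis
  obtain k where k: "(color_change H ^^ k) B (pverts H)"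
    using B(1) by (auto simp: zero_forcing_set_def dest: rtranclp_imp_relpowp)
  have "n = card B + k"
    using color_change_relpowp[OF k finB BV] assms(2) VH by simp
  \<comment> \<open>A complete run has \<open>n - card B \<ge> r + s\<close> forces, so it can be
    cut after the first \<open>r\<close>.\<close>
  then obtain m where "k = r + m" using small le_Suc_ex[of r k] by auto
  then obtain C where "(color_change H ^^ r) B C"
    using k by (auto simp: relpowp_add)
  note C = color_change_relpowp[OF this finB BV]
  then obtain U where U: "U \<subseteq> C" "card U = r" "\<forall>u\<in>U. white_neighbors H C u = {}"
    by blast
  have "card (pverts G - C) = n - (card B + r)"
    using C VH assms(2) by (simp add: card_Diff_subset)
  then have "s \<le> card (pverts G - C)" using small by simp
  then obtain W where W: "W \<subseteq> pverts G - C" "card W = s"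
    using obtain_subset_with_card_n by metis
  have "U \<times> W \<subseteq> parcs G"
  proof clarify
    fix u v assume "u \<in> U" "v \<in> W"
    \<comment> \<open>Since \<open>u\<close> is blue and \<open>v\<close> white, they are distinct,
      so non-adjacency in the complement means adjacency in \<open>G\<close>.\<close>
    then have "u \<in> pverts G" "v \<in> pverts G" "v \<notin> C" "u \<noteq> v"
      using U(1) W(1) C VH by auto
    moreover have "white_neighbors H C u = {}" using U(3) \<open>u \<in> U\<close> by blast
    ultimately show "(u, v) \<in> parcs G"
      by (auto simp: white_neighbors_def H_def complement_graph_def)
  qed
  moreover have "U \<subseteq> pverts G" "W \<subseteq> pverts G" "U \<inter> W = {}"
    using U(1) W(1) C VH by auto
  ultimately have "contains_complete_bipartite G r s"
    using contains_complete_bipartiteI[OF assms(1), of U W] U(2) W(2) by simp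
  with assms(4) show False ..
qed

end
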